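(* Consider the additive model $U(y)=\sum_{j=1}^p f_j(X_j)+\epsilon$ with true functions $\boldsymbol f=(f_1,\dots,f_p)$ and active set $S_0=\{j:f_j\ne0\}$, and the loss $\mathcal L_n$, oracle estimator $\boldsymbol f^*$ and one-step LLA estimator $\hat{\boldsymbol f}^{(1)}$ defined in the context. Suppose the penalty $P_\lambda(\cdot)$ satisfies, with constants $a_1>0$, $a_2>0$, $a>a_2$: (i) $P_\lambda(t)$ is increasing and concave on $[0,\infty)$ with $P_\lambda(0)=0$; (ii) $P_\lambda'(t)$ exists for $t>0$, and $P_\lambda'(0^+)\ge a_1\lambda$; (iii) $P_\lambda'(t)\ge a_1\lambda$ for all $t\in(0,a_2\lambda]$; (iv) $P_\lambda'(t)=0$ for all $t\ge a\lambda$. Let $a_0=\min(1,a_2)$ and assume $\min_{j\in S_0}\|f_j\|_{\mathcal M_j}>(a+1)\lambda_1$. (a) (Ridge initialization) If $\boldsymbol f^{\mathrm{init}}$ is the ridge estimator and $\|\boldsymbol f^{\mathrm{init}}-\boldsymbol f\|_\infty=o(\lambda_1)$ (with high probability), then with high probability $\hat{\boldsymbol f}^{(1)}=\boldsymbol f^*$. (b) (Elastic Net initialization) If $\boldsymbol f^{\mathrm{init}}$ is the Elastic Net estimator, $a_0+a_1<a$, and both $\|\boldsymbol f^{\mathrm{init}}-\boldsymbol f\|_{\max}\le a_0\lambda_1$ and $\|\nabla_{S_0^c}\mathcal L_n(\boldsymbol f^*,\lambda_2)\|_{\max}<a_1\lambda_1$ hold with high probability, then with high probability $\hat{\boldsymbol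 f}^{(1)}=\boldsymbol f^*$. Here "with high probability" means with probability tending to $1$ as $n\to\infty$.
   Context: $(\Omega_Y,d_Y)$ and $(\Omega_{X_j},d_{X_j})$, $j=1,\dots,p$, are metric spaces (the latter separable); $p\ge1$ does not increase with $n$. $(X_i,Y_i)$, $i=1,\dots,n$, with $X_i=(X_{i1},\dots,X_{ip})$, are i.i.d. copies of the random element $(X,Y)$ of $\prod_j\Omega_{X_j}\times\Omega_Y$. For each $j$, $\kappa_j$ is a positive definite kernel on $\Omega_{X_j}$ with RKHS $\mathcal M_j$. Standing boundedness assumption: for a constant $C$, $\sup_{j,x_j}\|\kappa_j(\cdot,x_j)\|_{\mathcal M_j}<C$, $(\sum_j\|f_j\|^2_{\mathcal M_j})^{1/2}<C$, $\mathbb E[\epsilon^2]<C$, $\sup_j\mathbb E[\kappa_j(X_j,X_j)]<C$. Fix $y,y_0\in\Omega_Y$; $U(y)=d_Y^2(Y,y)-d_Y^2(Y,y_0)$ and $U_i(y)=d_Y^2(Y_i,y)-d_Y^2(Y_i,y_0)$. The model is $U(y)=\sum_{j=1}^pf_j(X_j)+\epsilon$ with $f_j\in\mathcal M_j$, $\mathbb E[\epsilon\mid X]=0$. The tuning parameters $\lambda_1=\lambda_{1,n}>0$, $\lambda_2=\lambda_{2,n}>0$ satisfy $\lambda_1\to 0$. For $\boldsymbol g=(g_1,\dots,g_p)$, $g_j\in\mathcal M_j$, $$\mathcal L_n(\boldsymbol g,\lambda_2)=\frac1{2n}\sum_{i=1}^n\Big(U_i(y)-\sum_{j=1}^p\langle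 g_j,\kappa_j(\cdot,X_{ij})\rangle_{\mathcal M_j}\Big)^2+\frac{\lambda_2}2\sum_{j=1}^p\|g_j\|_{\mathcal M_j}^2 .$$ Its gradient in the $j$-th coordinate is $\nabla_j\mathcal L_n(\boldsymbol g,\lambda_2)=-\frac1n\sum_i\big(U_i(y)-\sum_k g_k(X_{ik})\big)\kappa_j(\cdot,X_{ij})+\lambda_2g_j\in\mathcal M_j$, and $\nabla_{S_0^c}\mathcal L_n=(\nabla_j\mathcal L_n)_{j\in S_0^c}$ with $S_0^c=\{1,\dots,p\}\setminus S_0$. For tuples, $\|\boldsymbol g\|_\infty=\|\boldsymbol g\|_{\max}=\max_j\|g_j\|_{\mathcal M_j}$. Oracle estimator: $\boldsymbol f^*=\arg\min\{\mathcal L_n(\boldsymbol g,\lambda_2): g_j=0\ \text{for all } j\in S_0^c\}$. Ridge estimator: the minimizer of $\mathcal L_n(\boldsymbol g,\lambda_2)$. Elastic Net estimator: the minimizer of $\mathcal L_n(\boldsymbol g,\lambda_2)+\lambda_1\sum_j\|g_j\|_{\mathcal M_j}$. One-step LLA (local linear approximation) estimator from an initial estimator $\boldsymbol f^{\mathrm{init}}$: $$\hat{\boldsymbol f}^{(1)}=\arg\min_{\boldsymbol g}\ \mathcal L_n(\boldsymbol g,\lambda_2)+\sum_{j=1}^p\hat w_j\|g_j\|_{\mathcal M_j},\qquad \hat w_j=P'_{\lambda_1}(\|f^{\mathrm{init}}_j\|_{\mathcal M_j}),$$ where $P'_{\lambda_1}(0)$ is understood as $P'_{\lambda_1}(0^+)$.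 *)

theory Defs
  imports "HOL-Probability.Probability" "HOL-Library.Landau_Symbols"
begin

section \<open>Metric spaces as measurable spaces\<close>

definition metric_borel :: "'a metric \<Rightarrow> 'a measure" where
  "metric_borel S = sigma (mspace S) {V. openin (mtopology_of S) V}"

definition separable_metric :: "'a metric \<Rightarrow> bool" where
  "separable_metric S \<longleftrightarrow>
     (\<exists>D. countable D \<and> D \<subseteq> mspace S \<and> mtopology_of S closure_of D = mspace S)"


section \<open>Kernels and reproducing kernel Hilbert spaces\<close>

definition pos_def_kernel :: "'a set \<Rightarrow> ('a \<Rightarrow> 'a \<Rightarrow> real) \<Rightarrow> bool" where
  "pos_def_kernel \<Omega> \<kappa> \<longleftrightarrow>
     (\<forall>s\<in>\<Omega>. \<forall>t\<in>\<Omega>. \<kappa> s t = \<kappa> t s) \<and>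
     (\<forall>F c. finite F \<and> F \<subseteq> \<Omega> \<longrightarrow> 0 \<le> (\<Sum>s\<in>F. \<Sum>t\<in>F. c s * c t * \<kappa> s t))"

text \<open>Real functions on a set \<open>\<Omega>\<close> are represented by functions on the whole type that vanish
  outside \<open>\<Omega>\<close>, so that they are closed under pointwise linear combinations and are determined by
  their values on \<open>\<Omega>\<close>. \<open>ksec \<Omega> \<kappa> x\<close> is the function \<open>\<kappa>(\<cdot>, x)\<close> in this representation.\<close>

definition ksec :: "'a set \<Rightarrow> ('a \<Rightarrow> 'a \<Rightarrow> real) \<Rightarrow> 'a \<Rightarrow> 'a \<Rightarrow> real" where
  "ksec \<Omega> \<kappa> x = (\<lambda>t. if t \<in> \<Omega> then \<kappa> t x else 0)"

type_synonym 'a inner = "('a \<Rightarrow> real) \<Rightarrow> ('a \<Rightarrow> real) \<Rightarrow> real"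

definition ip_norm :: "'a inner \<Rightarrow> ('a \<Rightarrow> real) \<Rightarrow> real" where
  "ip_norm ip f = sqrt (ip f f)"

text \<open>\<open>rkhs \<Omega> \<kappa> H ip\<close>: the set \<open>H\<close> of real functions on \<open>\<Omega>\<close> with the inner product \<open>ip\<close> (only its
  values on \<open>H\<close> matter) is a Hilbert space with reproducing kernel \<open>\<kappa>\<close>. By Moore--Aronszajn, \<open>H\<close>
  and \<open>ip\<close> on \<open>H\<close> exist and are unique for every positive definite \<open>\<kappa>\<close>.\<close>

definition rkhs ::
  "'a set \<Rightarrow> ('a \<Rightarrow> 'a \<Rightarrow> real) \<Rightarrow> ('a \<Rightarrow> real) set \<Rightarrow> 'a inner \<Rightarrow> bool" where
  "rkhs \<Omega> \<kappa> H ip \<longleftrightarrow>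
     \<comment> \<open>linear space of functions\<close>
     (\<forall>f\<in>H. \<forall>t. t \<notin> \<Omega> \<longrightarrow> f t = 0) \<and>
     (\<lambda>t. 0) \<in> H \<and>
     (\<forall>f\<in>H. \<forall>g\<in>H. (\<lambda>t. f t + g t) \<in> H) \<and>
     (\<forall>c. \<forall>f\<in>H. (\<lambda>t. c * f t) \<in> H) \<and>
     \<comment> \<open>inner product\<close>
     (\<forall>f\<in>H. \<forall>g\<in>H. ip f g = ip g f) \<and>
     (\<forall>f\<in>H. \<forall>g\<in>H. \<forall>h\<in>H. ip (\<lambda>t. f t + g t) h = ip f h + ip g h) \<and>
     (\<forall>c. \<forall>f\<in>H. \<forall>g\<in>H. ip (\<lambda>t. c * f t) g = c * ip f g) \<and>
     (\<forall>f\<in>H. 0 \<le> ip f f) \<and>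
     (\<forall>f\<in>H. ip f f = 0 \<longrightarrow> f = (\<lambda>t. 0)) \<and>
     \<comment> \<open>completeness\<close>
     Metric_space.mcomplete H (\<lambda>f g. ip_norm ip (\<lambda>t. f t - g t)) \<and>
     \<comment> \<open>reproducing kernel\<close>
     (\<forall>x\<in>\<Omega>. ksec \<Omega> \<kappa> x \<in> H) \<and>
     (\<forall>x\<in>\<Omega>. \<forall>f\<in>H. ip f (ksec \<Omega> \<kappa> x) = f x)"

text \<open>Maximum norm of the components with index in \<open>A\<close>; the inserted \<open>0\<close> only matters for
  \<open>A = {}\<close>.\<close>

definition tuple_max_norm ::
  "('j \<Rightarrow> 'a inner) \<Rightarrow> 'j set \<Rightarrow> ('j \<Rightarrow> 'a \<Rightarrow> real) \<Rightarrow> real" where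
  "tuple_max_norm ip A g = Max (insert 0 ((\<lambda>j. ip_norm (ip j) (g j)) ` A))"


section \<open>Loss, gradient and estimators\<close>

text \<open>\<open>\<Omega> j\<close>, \<open>\<kappa> j\<close>, \<open>H j\<close>, \<open>ip j\<close> are the \<open>j\<close>-th domain, kernel, RKHS and inner product;
  \<open>u i\<close> and \<open>x i j\<close> are the \<open>i\<close>-th response and its \<open>j\<close>-th covariate, \<open>i = 1, \<dots>, n\<close>.\<close>

definition loss ::
  "('j::finite \<Rightarrow> 'a set) \<Rightarrow> ('j \<Rightarrow> 'a \<Rightarrow> 'a \<Rightarrow> real) \<Rightarrow> ('j \<Rightarrow> 'a inner) \<Rightarrow>
   (nat \<Rightarrow> real) \<Rightarrow> (nat \<Rightarrow> 'j \<Rightarrow> 'a) \<Rightarrow> nat \<Rightarrow> real \<Rightarrow> ('j \<Rightarrow> 'a \<Rightarrow> real) \<Rightarrow> real" where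
  "loss \<Omega> \<kappa> ip u x n l2 g =
     1 / (2 * real n) *
       (\<Sum>i=1..n. (u i - (\<Sum>j\<in>UNIV. ip j (g j) (ksec (\<Omega> j) (\<kappa> j) (x i j))))\<^sup>2)
     + l2 / 2 * (\<Sum>j\<in>UNIV. (ip_norm (ip j) (g j))\<^sup>2)"

definition loss_grad ::
  "('j::finite \<Rightarrow> 'a set) \<Rightarrow> ('j \<Rightarrow> 'a \<Rightarrow> 'a \<Rightarrow> real) \<Rightarrow>
   (nat \<Rightarrow> real) \<Rightarrow> (nat \<Rightarrow> 'j \<Rightarrow> 'a) \<Rightarrow> nat \<Rightarrow> real \<Rightarrow> ('j \<Rightarrow> 'a \<Rightarrow> real) \<Rightarrow> 'j \<Rightarrow> 'a \<Rightarrow> real" where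
  "loss_grad \<Omega> \<kappa> u x n l2 g j = (\<lambda>t.
     - (1 / real n) *
       (\<Sum>i=1..n. (u i - (\<Sum>k\<in>UNIV. g k (x i k))) * ksec (\<Omega> j) (\<kappa> j) (x i j) t)
     + l2 * g j t)"

text \<open>The estimators are predicates on \<open>h\<close>: ``\<open>h\<close> is the minimizer''. For \<open>l2 > 0\<close> (and nonnegative
  weights) the objectives are strongly convex, so the minimizer exists and is unique.\<close>

definition oracle_estimator where
  "oracle_estimator \<Omega> \<kappa> H ip S u x n l2 h \<longleftrightarrow>
     is_arg_min (loss \<Omega> \<kappa> ip u x n l2)
       (\<lambda>g. (\<forall>j. g j \<in> H j) \<and> (\<forall>j. j \<notin> S \<longrightarrow> g j = (\<lambda>t. 0))) h"

definition ridge_estimator where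
  "ridge_estimator \<Omega> \<kappa> H ip u x n l2 h \<longleftrightarrow>
     is_arg_min (loss \<Omega> \<kappa> ip u x n l2) (\<lambda>g. \<forall>j. g j \<in> H j) h"

definition elastic_net_estimator where
  "elastic_net_estimator \<Omega> \<kappa> H ip u x n l1 l2 h \<longleftrightarrow>
     is_arg_min (\<lambda>g. loss \<Omega> \<kappa> ip u x n l2 g + l1 * (\<Sum>j\<in>UNIV. ip_norm (ip j) (g j)))
       (\<lambda>g. \<forall>j. g j \<in> H j) h"

text \<open>\<open>P\<close> is the penalty as a function of \<open>t\<close> for a fixed tuning parameter; at \<open>0\<close> its derivative
  is replaced by the right limit \<open>P'(0+)\<close>.\<close>

definition penalty_deriv :: "(real \<Rightarrow> real) \<Rightarrow> real \<Rightarrow> real" where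
  "penalty_deriv P t = (if t = 0 then Lim (at_right 0) (deriv P) else deriv P t)"

definition lla_estimator where
  "lla_estimator \<Omega> \<kappa> H ip P init u x n l2 h \<longleftrightarrow>
     is_arg_min (\<lambda>g. loss \<Omega> \<kappa> ip u x n l2 g
         + (\<Sum>j\<in>UNIV. penalty_deriv P (ip_norm (ip j) (init j)) * ip_norm (ip j) (g j)))
       (\<lambda>g. \<forall>j. g j \<in> H j) h"


section \<open>Events with high probability\<close>

text \<open>The probability of \<open>E n\<close> tends to \<open>1\<close>. Measurability of \<open>E n\<close> is not presupposed (kernels
  need not be measurable): \<open>E n\<close> has to contain events whose probabilities tend to \<open>1\<close>. If all
  \<open>E n\<close> are measurable, this says exactly that their probabilities tend to \<open>1\<close>.\<close>

definition whp :: "'w measure \<Rightarrow> (nat \<Rightarrow> 'w \<Rightarrow> bool) \<Rightarrow> bool" where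
  "whp M E \<longleftrightarrow>
     (\<exists>A. (\<forall>n. A n \<in> sets M \<and> A n \<subseteq> {\<omega> \<in> space M. E n \<omega>}) \<and>
          (\<lambda>n. measure M (A n)) \<longlonglongrightarrow> 1)"

lemma whp_iff_of_measurable:
  assumes M: "prob_space M" and E: "\<And>n. {\<omega> \<in> space M. E n \<omega>} \<in> sets M"
  shows "whp M E \<longleftrightarrow> (\<lambda>n. measure M {\<omega> \<in> space M. E n \<omega>}) \<longlonglongrightarrow> 1"
proof
  interpret prob_space M by (rule M)
  assume "whp M E"
  then obtain A where A: "\<And>n. A n \<in> sets M" "\<And>n. A n \<subseteq> {\<omega> \<in> space M. E n \<omega>}"
    and lim: "(\<lambda>n. prob (A n)) \<longlonglongrightarrow> 1"
    unfolding whp_def by blast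
  show "(\<lambda>n. prob {\<omega> \<in> space M. E n \<omega>}) \<longlonglongrightarrow> 1"
  proof (rule tendsto_sandwich[OF _ _ lim tendsto_const])
    show "\<forall>\<^sub>F n in sequentially. prob (A n) \<le> prob {\<omega> \<in> space M. E n \<omega>}"
      using A E by (intro always_eventually allI finite_measure_mono) auto
    show "\<forall>\<^sub>F n in sequentially. prob {\<omega> \<in> space M. E n \<omega>} \<le> 1"
      by simp
  qed
next
  assume "(\<lambda>n. measure M {\<omega> \<in> space M. E n \<omega>}) \<longlonglongrightarrow> 1"
  then show "whp M E"
    unfolding whp_def using E by (intro exI[of _ "\<lambda>n. {\<omega> \<in> space M. E n \<omega>}"]) auto
qed

end

theory Submission
  imports Defs
begin

text \<open>The penalty is flat beyond \<open>a \<lambda>\<^sub>1\<close> and has slope at least \<open>a\<^sub>1 \<lambda>\<^sub>1\<close> up to \<open>a\<^sub>2 \<lambda>\<^sub>1\<close>. An initial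
  estimator within \<open>a\<^sub>0 \<lambda>\<^sub>1\<close> of the truth therefore yields weight \<open>0\<close> on every active component, whose
  norm exceeds \<open>(a + 1) \<lambda>\<^sub>1\<close>, and weight at least \<open>a\<^sub>1 \<lambda>\<^sub>1\<close> on every inactive one. With such weights
  the oracle estimator satisfies the optimality conditions of the weighted problem as soon as its
  gradient has norm at most \<open>a\<^sub>1 \<lambda>\<^sub>1\<close> in the inactive coordinates: the gradient vanishes in the
  active coordinates, and elsewhere the weights dominate it. The ridge term makes the objective
  strongly convex, so the LLA minimizer is the oracle (\<open>lla_eq_oracle\<close>).

  In part (b) the gradient bound is an assumption. In part (a) it has to be derived, and the reason
  is that the loss is exactly quadratic. The ridge estimator is the unrestricted minimizer and has
  inactive components of norm at most \<open>r = o(\<lambda>\<^sub>1)\<close>. Deleting them gives a competitor of the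
  oracle whose loss exceeds the unrestricted minimum by \<open>O((C\<^sup>2 + \<lambda>\<^sub>2) r\<^sup>2)\<close>; hence the oracle is a near
  minimizer over the whole space. At a near minimizer of a quadratic functional the gradient is
  small (\<open>slope_near_minimum\<close>), here of norm at most \<open>p (C\<^sup>2 + \<lambda>\<^sub>2) r\<close>
  (\<open>oracle_grad_le_ridge_leakage\<close>).

  This is \<open>o(\<lambda>\<^sub>1)\<close> once \<open>\<lambda>\<^sub>2\<close> is known to be bounded, which the convergence of the ridge estimator
  \<open>g\<close> enforces. Comparing its loss with that of \<open>0\<close> shows that \<open>\<lambda>\<^sub>2 \<parallel>g\<^sub>j\<parallel>\<^sup>2\<close> is at most the average
  of the squared responses (\<open>ridge_shrinkage\<close>). For an active \<open>j\<close> the norm on the left stays away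
  from \<open>0\<close>, and the average has constant finite expectation \<open>V\<close>. As \<open>\<lambda>\<^sub>2\<close> is deterministic,
  integrating the inequality over an event of probability above one half bounds it
  (\<open>eventually_le_of_whp_le_average\<close>).\<close>

section \<open>Hilbert space geometry of a reproducing kernel space\<close>

text \<open>The discriminant inequality in a form that covers \<open>Q = 0\<close>. It serves twice: for the
  Cauchy--Schwarz inequality, and for the size of the gradient at a near minimizer of the loss.\<close>

lemma nonneg_quadratic_discriminant:
  fixes A B Q :: real
  assumes nonneg: "\<And>t. 0 \<le> A + t * B + t\<^sup>2 / 2 * Q"
  shows "B\<^sup>2 \<le> 2 * A * Q"
proof (cases "Q = 0")
  case True
  have "B = 0"
  proof (rule ccontr)
    assume "B \<noteq> 0"
    with nonneg[of "- (A + 1) / B"] True show False by simp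
  qed
  with True show ?thesis by simp
next
  case False
  have "Q > 0"
  proof (rule ccontr)
    assume "\<not> Q > 0"
    with False have Q: "Q < 0" by simp
    \<comment> \<open>far enough out for the negative quadratic term to dominate the other two\<close>
    define t where "t = max 1 (2 * (\<bar>A\<bar> + \<bar>B\<bar> + 1) / (- Q))"
    have t1: "t \<ge> 1" and "2 * (\<bar>A\<bar> + \<bar>B\<bar> + 1) / (- Q) \<le> t" by (simp_all add: t_def)
    then have tQ: "2 * (\<bar>A\<bar> + \<bar>B\<bar> + 1) \<le> t * (- Q)"
      using Q by (subst (asm) pos_divide_le_eq) auto
    have "2 * (\<bar>A\<bar> + \<bar>B\<bar> + 1) * t \<le> t * (- Q) * t"
      using tQ t1 by (intro mult_right_mono) auto
    moreover have "t * B \<le> t * \<bar>B\<bar>" using t1 by (intro mult_left_mono) auto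
    moreover have "\<bar>A\<bar> \<le> t * \<bar>A\<bar>" using t1 mult_right_mono[of 1 t "\<bar>A\<bar>"] by simp
    moreover have "2 * (\<bar>A\<bar> + \<bar>B\<bar> + 1) * t = 2 * (t * \<bar>A\<bar>) + 2 * (t * \<bar>B\<bar>) + 2 * t"
      and "t\<^sup>2 / 2 * Q = - (t * (- Q) * t) / 2"
      by (simp_all add: algebra_simps power2_eq_square)
    ultimately have "A + t * B + t\<^sup>2 / 2 * Q < 0"
      using t1 abs_ge_self[of A] by linarith
    with nonneg[of t] show False by simp
  qed
  have "A + (- B / Q) * B + (- B / Q)\<^sup>2 / 2 * Q = A - B\<^sup>2 / (2 * Q)"
    using \<open>Q > 0\<close> by (simp add: field_simps power2_eq_square)
  with nonneg[of "- B / Q"] have "B\<^sup>2 / (2 * Q) \<le> A" by simp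
  then show ?thesis using \<open>Q > 0\<close> by (simp add: field_simps)
qed

locale reproducing_kernel_space =
  fixes \<Omega> :: "'a set" and \<kappa> :: "'a \<Rightarrow> 'a \<Rightarrow> real" and H :: "('a \<Rightarrow> real) set" and ip :: "'a inner"
  assumes is_rkhs: "rkhs \<Omega> \<kappa> H ip"
begin

lemma zero_mem [simp]: "(\<lambda>t. 0) \<in> H"
  and add_mem [intro]: "f \<in> H \<Longrightarrow> g \<in> H \<Longrightarrow> (\<lambda>t. f t + g t) \<in> H"
  and scale_mem [intro]: "f \<in> H \<Longrightarrow> (\<lambda>t. c * f t) \<in> H"
  and ksec_mem [intro]: "z \<in> \<Omega> \<Longrightarrow> ksec \<Omega> \<kappa> z \<in> H"
  and ip_commute: "f \<in> H \<Longrightarrow> g \<in> H \<Longrightarrow> ip f g = ip g f"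
  and ip_add_left: "f \<in> H \<Longrightarrow> g \<in> H \<Longrightarrow> h \<in> H \<Longrightarrow> ip (\<lambda>t. f t + g t) h = ip f h + ip g h"
  and ip_scale_left: "f \<in> H \<Longrightarrow> g \<in> H \<Longrightarrow> ip (\<lambda>t. c * f t) g = c * ip f g"
  and ip_nonneg: "f \<in> H \<Longrightarrow> 0 \<le> ip f f"
  and ip_eq_0: "f \<in> H \<Longrightarrow> ip f f = 0 \<Longrightarrow> f = (\<lambda>t. 0)"
  and ip_ksec: "z \<in> \<Omega> \<Longrightarrow> f \<in> H \<Longrightarrow> ip f (ksec \<Omega> \<kappa> z) = f z"
  using is_rkhs unfolding rkhs_def by blast+

lemma diff_mem [intro]:
  assumes "f \<in> H" "g \<in> H" shows "(\<lambda>t. f t - g t) \<in> H"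
  using add_mem[OF assms(1) scale_mem[OF assms(2), of "- 1"]] by simp

lemma sum_mem:
  "finite I \<Longrightarrow> (\<And>i. i \<in> I \<Longrightarrow> h i \<in> H) \<Longrightarrow> (\<lambda>t. \<Sum>i\<in>I. c i * h i t) \<in> H"
proof (induction I rule: finite_induct)
  case (insert i I)
  then have "(\<lambda>t. c i * h i t + (\<Sum>i\<in>I. c i * h i t)) \<in> H" by (intro add_mem scale_mem) auto
  with insert show ?case by simp
qed simp

lemma ip_zero_left: "g \<in> H \<Longrightarrow> ip (\<lambda>t. 0) g = 0"
  using ip_scale_left[of g g 0] by simp

lemma ip_sum_left:
  assumes "finite I" "\<And>i. i \<in> I \<Longrightarrow> h i \<in> H" "g \<in> H"
  shows "ip (\<lambda>t. \<Sum>i\<in>I. c i * h i t) g = (\<Sum>i\<in>I. c i * ip (h i) g)"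
  using assms
proof (induction I rule: finite_induct)
  case empty
  then show ?case by (simp add: ip_zero_left)
next
  case (insert i I)
  have "(\<lambda>t. \<Sum>i\<in>I. c i * h i t) \<in> H" by (rule sum_mem) (use insert in auto)
  with insert show ?case by (simp add: ip_add_left scale_mem ip_scale_left)
qed

lemma ip_add_scale_square:
  assumes "f \<in> H" "g \<in> H"
  shows "ip (\<lambda>t. f t + s * g t) (\<lambda>t. f t + s * g t) = ip f f + 2 * s * ip f g + s\<^sup>2 * ip g g"
proof -
  let ?h = "\<lambda>t. f t + s * g t"
  have h: "?h \<in> H" using assms by auto
  have "ip ?h ?h = ip f ?h + s * ip g ?h"
    using assms h by (simp add: ip_add_left scale_mem ip_scale_left)
  also have "\<dots> = ip ?h f + s * ip ?h g" using assms h by (simp add: ip_commute)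
  also have "\<dots> = ip f f + s * ip g f + s * (ip f g + s * ip g g)"
    using assms by (simp add: ip_add_left scale_mem ip_scale_left)
  also have "\<dots> = ip f f + 2 * s * ip f g + s\<^sup>2 * ip g g"
    using ip_commute[OF assms] by (simp add: algebra_simps power2_eq_square)
  finally show ?thesis .
qed

lemma ip_norm_square: "f \<in> H \<Longrightarrow> (ip_norm ip f)\<^sup>2 = ip f f"
  by (simp add: ip_norm_def ip_nonneg)

lemma ip_norm_nonneg: "f \<in> H \<Longrightarrow> 0 \<le> ip_norm ip f"
  by (simp add: ip_norm_def ip_nonneg)

lemma ip_norm_zero: "ip_norm ip (\<lambda>t. 0) = 0"
  by (simp add: ip_norm_def ip_zero_left)

lemma cauchy_schwarz:
  assumes "f \<in> H" "g \<in> H"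
  shows "\<bar>ip f g\<bar> \<le> ip_norm ip f * ip_norm ip g"
proof -
  have "(2 * ip f g)\<^sup>2 \<le> 2 * ip f f * (2 * ip g g)"
  proof (rule nonneg_quadratic_discriminant)
    fix t
    have "0 \<le> ip (\<lambda>x. f x + t * g x) (\<lambda>x. f x + t * g x)"
      using assms by (intro ip_nonneg add_mem scale_mem)
    then show "0 \<le> ip f f + t * (2 * ip f g) + t\<^sup>2 / 2 * (2 * ip g g)"
      using ip_add_scale_square[OF assms, of t] by (simp add: algebra_simps)
  qed
  then have "\<bar>ip f g\<bar>\<^sup>2 \<le> (ip_norm ip f * ip_norm ip g)\<^sup>2"
    using assms by (simp add: power_mult_distrib ip_norm_square)
  then show ?thesis
    by (rule power2_le_imp_le) (use assms in \<open>simp add: ip_norm_nonneg\<close>)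
qed

lemma triangle_ineq:
  assumes "f \<in> H" "g \<in> H"
  shows "ip_norm ip (\<lambda>t. f t + g t) \<le> ip_norm ip f + ip_norm ip g"
proof (rule power2_le_imp_le)
  show "0 \<le> ip_norm ip f + ip_norm ip g" using assms by (simp add: ip_norm_nonneg)
  have "(ip_norm ip (\<lambda>t. f t + g t))\<^sup>2 = (ip_norm ip f)\<^sup>2 + 2 * ip f g + (ip_norm ip g)\<^sup>2"
    using assms ip_add_scale_square[OF assms, of 1] by (simp add: ip_norm_square add_mem)
  then show "(ip_norm ip (\<lambda>t. f t + g t))\<^sup>2 \<le> (ip_norm ip f + ip_norm ip g)\<^sup>2"
    using cauchy_schwarz[OF assms] by (simp add: power2_sum)
qed

lemma reverse_triangle_ineq:
  assumes "f \<in> H" "g \<in> H"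
  shows "ip_norm ip f - ip_norm ip (\<lambda>t. g t - f t) \<le> ip_norm ip g"
proof -
  have d: "(\<lambda>t. g t - f t) \<in> H" using assms by auto
  have "ip_norm ip (\<lambda>t. g t + (- 1) * (g t - f t)) \<le> ip_norm ip g + ip_norm ip (\<lambda>t. (- 1) * (g t - f t))"
    using assms d by (intro triangle_ineq scale_mem)
  moreover have "ip_norm ip (\<lambda>t. (- 1) * (g t - f t)) = ip_norm ip (\<lambda>t. g t - f t)"
    using ip_add_scale_square[OF zero_mem d, of "- 1"] d by (simp add: ip_norm_def ip_zero_left)
  ultimately show ?thesis by simp
qed

lemma eval_le:
  assumes "z \<in> \<Omega>" "f \<in> H" "ip_norm ip (ksec \<Omega> \<kappa> z) \<le> C"
  shows "\<bar>f z\<bar> \<le> ip_norm ip f * C"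
  using cauchy_schwarz[OF assms(2) ksec_mem[OF assms(1)]] assms
    mult_left_mono[OF assms(3) ip_norm_nonneg[OF assms(2)]]
  by (simp add: ip_ksec)

end


section \<open>The loss as a quadratic functional\<close>

text \<open>Everything up to the choice of the weights is deterministic and takes place on one sample.\<close>

locale additive_sample =
  fixes \<Omega> :: "'j::finite \<Rightarrow> 'a set" and \<kappa> :: "'j \<Rightarrow> 'a \<Rightarrow> 'a \<Rightarrow> real"
    and H :: "'j \<Rightarrow> ('a \<Rightarrow> real) set" and ip :: "'j \<Rightarrow> 'a inner"
    and u :: "nat \<Rightarrow> real" and x :: "nat \<Rightarrow> 'j \<Rightarrow> 'a" and n :: nat and l2 C :: real
  assumes rkhs: "\<And>j. rkhs (\<Omega> j) (\<kappa> j) (H j) (ip j)"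
    and covariates: "\<And>i j. i \<in> {1..n} \<Longrightarrow> x i j \<in> \<Omega> j"
    and l2_pos: "0 < l2"
    and kernel_bound: "\<And>j z. z \<in> \<Omega> j \<Longrightarrow> ip_norm (ip j) (ksec (\<Omega> j) (\<kappa> j) z) \<le> C"
    and C_nonneg: "0 \<le> C"
begin

sublocale comp: reproducing_kernel_space "\<Omega> j" "\<kappa> j" "H j" "ip j" for j
  by unfold_locales (rule rkhs)

abbreviation "\<L> \<equiv> loss \<Omega> \<kappa> ip u x n l2"
abbreviation "grad \<equiv> loss_grad \<Omega> \<kappa> u x n l2"

text \<open>The loss is quadratic along every line \<open>g + s e\<close>: \<open>slope g e\<close> is its derivative at
  \<open>s = 0\<close> and \<open>curvature e\<close> its constant second derivative, the quadratic form of the empirical second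
  moment operator plus \<open>\<lambda>\<^sub>2\<close> times the identity.\<close>

definition slope :: "('j \<Rightarrow> 'a \<Rightarrow> real) \<Rightarrow> ('j \<Rightarrow> 'a \<Rightarrow> real) \<Rightarrow> real" where
  "slope g e = (\<Sum>j\<in>UNIV. ip j (grad g j) (e j))"

definition curvature :: "('j \<Rightarrow> 'a \<Rightarrow> real) \<Rightarrow> real" where
  "curvature e = 1 / real n * (\<Sum>i=1..n. (\<Sum>k\<in>UNIV. e k (x i k))\<^sup>2) + l2 * (\<Sum>k\<in>UNIV. ip k (e k) (e k))"

lemma grad_mem:
  assumes "\<And>j. g j \<in> H j" shows "grad g j \<in> H j"
proof -
  have "(\<lambda>t. - (1 / real n) * (\<Sum>i=1..n. (u i - (\<Sum>k\<in>UNIV. g k (x i k))) * ksec (\<Omega> j) (\<kappa> j) (x i j) t)) \<in> H j"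
    by (intro comp.scale_mem comp.sum_mem comp.ksec_mem covariates) auto
  then show ?thesis
    unfolding loss_grad_def using assms by (rule comp.add_mem[OF _ comp.scale_mem])
qed

lemma ip_grad:
  assumes g: "\<And>j. g j \<in> H j" and v: "v \<in> H j"
  shows "ip j (grad g j) v =
    - (1 / real n) * (\<Sum>i=1..n. (u i - (\<Sum>k\<in>UNIV. g k (x i k))) * v (x i j)) + l2 * ip j (g j) v"
proof -
  let ?F = "\<lambda>t. \<Sum>i=1..n. (u i - (\<Sum>k\<in>UNIV. g k (x i k))) * ksec (\<Omega> j) (\<kappa> j) (x i j) t"
  have F: "?F \<in> H j" by (intro comp.sum_mem comp.ksec_mem covariates) auto
  have "ip j (grad g j) v = - (1 / real n) * ip j ?F v + l2 * ip j (g j) v"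
    unfolding loss_grad_def using comp.scale_mem[OF F] comp.scale_mem[OF g[of j]] F g v
    by (simp only: comp.ip_add_left comp.ip_scale_left)
  also have "ip j ?F v
      = (\<Sum>i=1..n. (u i - (\<Sum>k\<in>UNIV. g k (x i k))) * ip j (ksec (\<Omega> j) (\<kappa> j) (x i j)) v)"
    by (rule comp.ip_sum_left) (use v covariates in auto)
  also have "\<dots> = (\<Sum>i=1..n. (u i - (\<Sum>k\<in>UNIV. g k (x i k))) * v (x i j))"
  proof (rule sum.cong[OF refl])
    fix i assume "i \<in> {1..n}"
    then have "ip j (ksec (\<Omega> j) (\<kappa> j) (x i j)) v = v (x i j)"
      using comp.ip_commute[OF comp.ksec_mem v] comp.ip_ksec[OF _ v] covariates by metis
    then show "(u i - (\<Sum>k\<in>UNIV. g k (x i k))) * ip j (ksec (\<Omega> j) (\<kappa> j) (x i j)) v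
        = (u i - (\<Sum>k\<in>UNIV. g k (x i k))) * v (x i j)" by simp
  qed
  finally show ?thesis .
qed

lemma slope_single:
  assumes "\<And>j. g j \<in> H j"
  shows "slope g (\<lambda>k. if k = j then v else (\<lambda>t. 0)) = ip j (grad g j) v"
proof -
  have "slope g (\<lambda>k. if k = j then v else (\<lambda>t. 0))
      = (\<Sum>k\<in>{j}. ip k (grad g k) (if k = j then v else (\<lambda>t. 0)))"
    unfolding slope_def
    by (intro sum.mono_neutral_right)
      (auto simp: comp.ip_commute[OF _ comp.zero_mem] comp.ip_zero_left grad_mem assms)
  then show ?thesis by simp
qed

lemma slope_eq:
  assumes g: "\<And>j. g j \<in> H j" and e: "\<And>j. e j \<in> H j"
  shows "slope g e =
    - (1 / real n) * (\<Sum>i=1..n. (u i - (\<Sum>k\<in>UNIV. g k (x i k))) * (\<Sum>j\<in>UNIV. e j (x i j)))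
    + l2 * (\<Sum>j\<in>UNIV. ip j (g j) (e j))"
proof -
  have "(\<Sum>j\<in>UNIV. \<Sum>i=1..n. (u i - (\<Sum>k\<in>UNIV. g k (x i k))) * e j (x i j))
      = (\<Sum>i=1..n. (u i - (\<Sum>k\<in>UNIV. g k (x i k))) * (\<Sum>j\<in>UNIV. e j (x i j)))"
    by (subst sum.swap) (simp add: sum_distrib_left)
  then show ?thesis
    unfolding slope_def ip_grad[OF g e] sum.distrib sum_distrib_left[symmetric] by simp
qed

lemma loss_eq:
  assumes "\<And>j. g j \<in> H j"
  shows "\<L> g = 1 / (2 * real n) * (\<Sum>i=1..n. (u i - (\<Sum>j\<in>UNIV. g j (x i j)))\<^sup>2)
    + l2 / 2 * (\<Sum>j\<in>UNIV. ip j (g j) (g j))"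
  using assms covariates unfolding loss_def by (simp add: comp.ip_ksec comp.ip_norm_square)

lemma loss_expansion:
  assumes g: "\<And>j. g j \<in> H j" and e: "\<And>j. e j \<in> H j"
  shows "\<L> (\<lambda>j t. g j t + s * e j t) = \<L> g + s * slope g e + s\<^sup>2 / 2 * curvature e"
proof -
  let ?R = "\<lambda>i. u i - (\<Sum>k\<in>UNIV. g k (x i k))"
  let ?E = "\<lambda>i. \<Sum>k\<in>UNIV. e k (x i k)"
  have mem: "(\<lambda>t. g j t + s * e j t) \<in> H j" for j
    using g e by (intro comp.add_mem comp.scale_mem)
  have "(u i - (\<Sum>k\<in>UNIV. g k (x i k) + s * e k (x i k)))\<^sup>2
      = (?R i)\<^sup>2 - 2 * s * (?R i * ?E i) + s\<^sup>2 * (?E i)\<^sup>2" for i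
    by (simp add: sum.distrib sum_distrib_left[symmetric] power2_eq_square algebra_simps)
  then have 1: "(\<Sum>i=1..n. (u i - (\<Sum>k\<in>UNIV. g k (x i k) + s * e k (x i k)))\<^sup>2)
      = (\<Sum>i=1..n. (?R i)\<^sup>2) - 2 * s * (\<Sum>i=1..n. ?R i * ?E i) + s\<^sup>2 * (\<Sum>i=1..n. (?E i)\<^sup>2)"
    by (simp add: sum.distrib sum_subtractf sum_distrib_left)
  have 2: "(\<Sum>j\<in>UNIV. ip j (\<lambda>t. g j t + s * e j t) (\<lambda>t. g j t + s * e j t))
      = (\<Sum>j\<in>UNIV. ip j (g j) (g j)) + 2 * s * (\<Sum>j\<in>UNIV. ip j (g j) (e j))
        + s\<^sup>2 * (\<Sum>j\<in>UNIV. ip j (e j) (e j))"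
    using g e by (simp add: comp.ip_add_scale_square sum.distrib sum_distrib_left)
  show ?thesis
    unfolding loss_eq[OF mem] loss_eq[OF g] slope_eq[OF g e] curvature_def 1 2
    by (cases "n = 0") (simp_all add: field_simps)
qed

lemma curvature_ge:
  "l2 * (\<Sum>k\<in>UNIV. ip k (e k) (e k)) \<le> curvature e"
  unfolding curvature_def by (simp add: sum_nonneg)

text \<open>By the reproducing property a component of norm at most \<open>r\<close> is bounded by \<open>r C\<close> at the
  sample points. The square of the cardinality absorbs the sum over the components in both terms.\<close>

lemma curvature_le:
  assumes e: "\<And>k. e k \<in> H k" and supp: "\<And>k. k \<notin> K \<Longrightarrow> e k = (\<lambda>t. 0)"
    and r: "\<And>k. k \<in> K \<Longrightarrow> ip_norm (ip k) (e k) \<le> r"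
  shows "curvature e \<le> (real (card K))\<^sup>2 * (C\<^sup>2 + l2) * r\<^sup>2"
proof -
  have "(\<Sum>k\<in>UNIV. e k (x i k))\<^sup>2 \<le> (real (card K) * (r * C))\<^sup>2" if i: "i \<in> {1..n}" for i
  proof -
    have "\<bar>e k (x i k)\<bar> \<le> r * C" if "k \<in> K" for k
      using comp.eval_le[OF covariates[OF i] e kernel_bound[OF covariates[OF i]]]
        mult_right_mono[OF r[OF that] C_nonneg] by (rule order_trans)
    then have "(\<Sum>k\<in>K. \<bar>e k (x i k)\<bar>) \<le> real (card K) * (r * C)"
      by (rule sum_bounded_above)
    moreover have "(\<Sum>k\<in>UNIV. e k (x i k)) = (\<Sum>k\<in>K. e k (x i k))"
      by (intro sum.mono_neutral_right) (auto simp: supp)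
    ultimately have "\<bar>\<Sum>k\<in>UNIV. e k (x i k)\<bar> \<le> real (card K) * (r * C)"
      using sum_abs[of "\<lambda>k. e k (x i k)" K] by linarith
    then show ?thesis by (metis abs_ge_zero power2_abs power_mono)
  qed
  then have "(\<Sum>i=1..n. (\<Sum>k\<in>UNIV. e k (x i k))\<^sup>2) \<le> real (card {1..n}) * (real (card K) * (r * C))\<^sup>2"
    by (rule sum_bounded_above)
  then have 1: "1 / real n * (\<Sum>i=1..n. (\<Sum>k\<in>UNIV. e k (x i k))\<^sup>2) \<le> (real (card K) * (r * C))\<^sup>2"
    by (cases "n = 0") (simp_all add: field_simps)
  have sq: "ip k (e k) (e k) \<le> r\<^sup>2" if "k \<in> K" for k
    using power_mono[OF r[OF that] comp.ip_norm_nonneg[OF e], of 2] e by (simp add: comp.ip_norm_square)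
  have "(\<Sum>k\<in>UNIV. ip k (e k) (e k)) = (\<Sum>k\<in>K. ip k (e k) (e k))"
    by (intro sum.mono_neutral_right) (auto simp: supp comp.ip_zero_left)
  also have "\<dots> \<le> real (card K) * r\<^sup>2" using sq by (rule sum_bounded_above)
  also have "\<dots> \<le> (real (card K))\<^sup>2 * r\<^sup>2"
    by (intro mult_right_mono) (cases "card K", simp_all add: power2_eq_square)
  finally have 2: "l2 * (\<Sum>k\<in>UNIV. ip k (e k) (e k)) \<le> l2 * ((real (card K))\<^sup>2 * r\<^sup>2)"
    using l2_pos by simp
  show ?thesis
    using 1 2 unfolding curvature_def by (simp add: power_mult_distrib algebra_simps)
qed

text \<open>Along the line the loss is a parabola of known curvature that never falls more
  than \<open>\<delta>\<close> below its value at \<open>s = 0\<close>; this limits its slope there. With \<open>\<delta> = 0\<close> the lemma is the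
  first-order condition at a minimizer.\<close>

lemma slope_near_minimum:
  assumes g: "\<And>j. g j \<in> H j" and e: "\<And>j. e j \<in> H j"
    and min: "\<And>s. \<L> g - \<delta> \<le> \<L> (\<lambda>j t. g j t + s * e j t)"
  shows "(slope g e)\<^sup>2 \<le> 2 * \<delta> * curvature e"
proof (rule nonneg_quadratic_discriminant)
  show "0 \<le> \<delta> + s * slope g e + s\<^sup>2 / 2 * curvature e" for s
    using min[of s] loss_expansion[OF g e, of s] by simp
qed


section \<open>Oracle, ridge and LLA estimators on a fixed sample\<close>

lemma oracleD:
  assumes "oracle_estimator \<Omega> \<kappa> H ip S u x n l2 h"
  shows oracle_mem: "h j \<in> H j" and oracle_support: "j \<notin> S \<Longrightarrow> h j = (\<lambda>t. 0)"
    and oracle_minimal: "(\<And>j. g j \<in> H j) \<Longrightarrow> (\<And>j. j \<notin> S \<Longrightarrow> g j = (\<lambda>t. 0)) \<Longrightarrow> \<L> h \<le> \<L> g"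
proof -
  show "h j \<in> H j" "j \<notin> S \<Longrightarrow> h j = (\<lambda>t. 0)"
    using assms unfolding oracle_estimator_def is_arg_min_def by auto
  show "\<L> h \<le> \<L> g" if "\<And>j. g j \<in> H j" "\<And>j. j \<notin> S \<Longrightarrow> g j = (\<lambda>t. 0)"
    using assms that unfolding oracle_estimator_def is_arg_min_def by (metis not_less)
qed

text \<open>Facts about the oracle thus apply to the ridge estimator with \<open>S = UNIV\<close>.\<close>

lemma ridge_is_full_oracle:
  "ridge_estimator \<Omega> \<kappa> H ip u x n l2 h \<longleftrightarrow> oracle_estimator \<Omega> \<kappa> H ip UNIV u x n l2 h"
  unfolding ridge_estimator_def oracle_estimator_def by simp

lemma oracle_slope_zero:
  assumes h: "oracle_estimator \<Omega> \<kappa> H ip S u x n l2 h"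
    and e: "\<And>j. e j \<in> H j" and supp: "\<And>j. j \<notin> S \<Longrightarrow> e j = (\<lambda>t. 0)"
  shows "slope h e = 0"
proof -
  note D = oracleD[OF h]
  have "(slope h e)\<^sup>2 \<le> 2 * 0 * curvature e"
  proof (rule slope_near_minimum[OF D(1) e])
    fix s
    have "(\<lambda>t. h j t + s * e j t) \<in> H j" for j
      using D(1) e by (intro comp.add_mem comp.scale_mem)
    then show "\<L> h - 0 \<le> \<L> (\<lambda>j t. h j t + s * e j t)"
      by (simp, intro D(3)) (auto simp: D(2) supp)
  qed
  then show ?thesis by simp
qed

lemma oracle_grad_zero:
  assumes h: "oracle_estimator \<Omega> \<kappa> H ip S u x n l2 h" and j: "j \<in> S"
  shows "grad h j = (\<lambda>t. 0)"
proof -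
  have mem: "grad h j \<in> H j" by (rule grad_mem) (rule oracle_mem[OF h])
  let ?e = "\<lambda>k. if k = j then grad h j else (\<lambda>t. 0)"
  have "slope h ?e = 0"
    by (rule oracle_slope_zero[OF h]) (use mem j in auto)
  then show ?thesis using slope_single[OF oracle_mem[OF h]] comp.ip_eq_0[OF mem] by simp
qed

text \<open>Sufficiency of the optimality conditions, together with uniqueness. Passing from \<open>h\<close> to any
  \<open>g\<close> changes the objective by at least half the curvature of \<open>g - h\<close>, since on inactive coordinates
  the weights outweigh the slope of the loss. For a minimizer \<open>g\<close> the curvature has to be \<open>0\<close>, and
  strong convexity gives \<open>g = h\<close>.\<close>

lemma lla_eq_oracle:
  assumes h: "oracle_estimator \<Omega> \<kappa> H ip S u x n l2 h"
    and g: "lla_estimator \<Omega> \<kappa> H ip p init u x n l2 g"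
    and active: "\<And>j. j \<in> S \<Longrightarrow> penalty_deriv p (ip_norm (ip j) (init j)) = 0"
    and inactive: "\<And>j. j \<notin> S \<Longrightarrow>
      ip_norm (ip j) (grad h j) \<le> penalty_deriv p (ip_norm (ip j) (init j))"
  shows "g = h"
proof -
  define w where "w j = penalty_deriv p (ip_norm (ip j) (init j))" for j
  note h_mem = oracle_mem[OF h] and h_supp = oracle_support[OF h]
  have g_mem: "g j \<in> H j" for j
    using g unfolding lla_estimator_def is_arg_min_def by blast
  define d where "d j = (\<lambda>t. g j t - h j t)" for j
  have d_mem: "d j \<in> H j" for j unfolding d_def using g_mem h_mem by auto
  have "\<L> g + (\<Sum>j\<in>UNIV. w j * ip_norm (ip j) (g j)) \<le> \<L> h + (\<Sum>j\<in>UNIV. w j * ip_norm (ip j) (h j))"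
    using g h_mem unfolding lla_estimator_def is_arg_min_def w_def by (auto simp: not_less)
  also have "(\<Sum>j\<in>UNIV. w j * ip_norm (ip j) (h j)) = 0"
  proof (rule sum.neutral, rule ballI)
    show "w j * ip_norm (ip j) (h j) = 0" for j
      using active h_supp by (cases "j \<in> S") (simp_all add: w_def comp.ip_norm_zero)
  qed
  also have "\<L> g = \<L> h + slope h d + curvature d / 2"
    using loss_expansion[OF h_mem d_mem, of 1] by (simp add: d_def[abs_def])
  finally have "slope h d + curvature d / 2 + (\<Sum>j\<in>UNIV. w j * ip_norm (ip j) (g j)) \<le> 0" by simp
  moreover have "0 \<le> slope h d + (\<Sum>j\<in>UNIV. w j * ip_norm (ip j) (g j))"
    unfolding slope_def sum.distrib[symmetric]
  proof (rule sum_nonneg)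
    fix j
    show "0 \<le> ip j (grad h j) (d j) + w j * ip_norm (ip j) (g j)"
    proof (cases "j \<in> S")
      case True
      then show ?thesis
        using active oracle_grad_zero[OF h True] d_mem by (simp add: w_def comp.ip_zero_left)
    next
      case False
      have "d j = g j" by (simp add: d_def h_supp[OF False])
      moreover have "\<bar>ip j (grad h j) (g j)\<bar> \<le> ip_norm (ip j) (grad h j) * ip_norm (ip j) (g j)"
        using grad_mem[OF h_mem] g_mem by (rule comp.cauchy_schwarz)
      moreover have "\<dots> \<le> w j * ip_norm (ip j) (g j)"
        unfolding w_def using inactive[OF False] comp.ip_norm_nonneg[OF g_mem] by (rule mult_right_mono)
      ultimately show ?thesis by (smt (verit))
    qed
  qed
  ultimately have "curvature d \<le> 0" by linarith
  then have "l2 * (\<Sum>k\<in>UNIV. ip k (d k) (d k)) \<le> 0" using curvature_ge[of d] by linarith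
  then have "(\<Sum>k\<in>UNIV. ip k (d k) (d k)) \<le> 0" using l2_pos by (simp add: mult_le_0_iff)
  then have "(\<Sum>k\<in>UNIV. ip k (d k) (d k)) = 0"
    by (intro antisym sum_nonneg comp.ip_nonneg d_mem)
  then have "ip k (d k) (d k) = 0" for k
    using sum_nonneg_eq_0_iff[of UNIV "\<lambda>k. ip k (d k) (d k)"] comp.ip_nonneg[OF d_mem] by simp
  then have "d k = (\<lambda>t. 0)" for k using comp.ip_eq_0[OF d_mem] by blast
  then show ?thesis by (auto simp: d_def fun_eq_iff)
qed

text \<open>Since the ridge estimator \<open>g\<close> is a stationary point, deleting its inactive part \<open>b\<close> raises the
  loss by exactly half the curvature of \<open>b\<close>. The oracle \<open>h\<close> does at least as well as the truncated
  ridge estimator, so it is within that amount of the unrestricted minimum.\<close>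

lemma oracle_grad_le_ridge_leakage:
  assumes h: "oracle_estimator \<Omega> \<kappa> H ip S u x n l2 h"
    and g: "ridge_estimator \<Omega> \<kappa> H ip u x n l2 g"
    and leak: "\<And>k. k \<notin> S \<Longrightarrow> ip_norm (ip k) (g k) \<le> r" and r: "0 \<le> r"
  shows "ip_norm (ip j) (grad h j) \<le> real CARD('j) * (C\<^sup>2 + l2) * r"
proof -
  define N where "N = ip_norm (ip j) (grad h j)"
  define b where "b k = (if k \<in> S then (\<lambda>t. 0) else g k)" for k
  define e where "e k = (if k = j then grad h j else (\<lambda>t. 0))" for k
  note h_mem = oracle_mem[OF h]
  note g' = g[unfolded ridge_is_full_oracle]
  note g_mem = oracle_mem[OF g']
  have mem: "grad h j \<in> H j" by (rule grad_mem) (rule h_mem)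
  have N0: "0 \<le> N" unfolding N_def using mem by (rule comp.ip_norm_nonneg)
  have b_mem: "b k \<in> H k" for k by (simp add: b_def g_mem)
  have e_mem: "e k \<in> H k" for k using mem by (simp add: e_def)
  have trunc: "(\<lambda>t. g k t + (- 1) * b k t) \<in> H k" for k
    using g_mem b_mem by (intro comp.add_mem comp.scale_mem)
  have "\<L> h \<le> \<L> (\<lambda>k t. g k t + (- 1) * b k t)"
    by (rule oracle_minimal[OF h]) (use trunc in \<open>auto simp: b_def\<close>)
  also have "\<dots> = \<L> g + curvature b / 2"
    using loss_expansion[OF g_mem b_mem, of "- 1"] oracle_slope_zero[OF g', of b] b_mem by simp
  finally have gap: "\<L> h - curvature b / 2 \<le> \<L> g" by simp
  \<comment> \<open>moving along the \<open>j\<close>-th gradient itself makes the slope its squared norm\<close>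
  have "(slope h e)\<^sup>2 \<le> 2 * (curvature b / 2) * curvature e"
  proof (rule slope_near_minimum[OF h_mem e_mem])
    fix s
    have "(\<lambda>t. h k t + s * e k t) \<in> H k" for k
      using h_mem e_mem by (intro comp.add_mem comp.scale_mem)
    then have "\<L> g \<le> \<L> (\<lambda>k t. h k t + s * e k t)" by (intro oracle_minimal[OF g']) auto
    with gap show "\<L> h - curvature b / 2 \<le> \<L> (\<lambda>k t. h k t + s * e k t)" by simp
  qed
  moreover have "slope h e = N\<^sup>2"
    using slope_single[OF h_mem, of j "grad h j"] mem
    by (simp add: e_def[abs_def] N_def comp.ip_norm_square)
  moreover have "curvature b * curvature e
      \<le> ((real CARD('j))\<^sup>2 * (C\<^sup>2 + l2) * r\<^sup>2) * ((C\<^sup>2 + l2) * N\<^sup>2)"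
  proof (rule mult_mono)
    show "curvature b \<le> (real CARD('j))\<^sup>2 * (C\<^sup>2 + l2) * r\<^sup>2"
      using b_mem leak r by (intro curvature_le) (auto simp: b_def comp.ip_norm_zero)
    show "curvature e \<le> (C\<^sup>2 + l2) * N\<^sup>2"
      using curvature_le[of e "{j}" N] e_mem by (simp add: e_def N_def)
    show "0 \<le> (real CARD('j))\<^sup>2 * (C\<^sup>2 + l2) * r\<^sup>2" using l2_pos by simp
    have "0 \<le> l2 * (\<Sum>k\<in>UNIV. ip k (e k) (e k))"
      using l2_pos e_mem by (intro mult_nonneg_nonneg sum_nonneg comp.ip_nonneg) auto
    then show "0 \<le> curvature e" using curvature_ge[of e] by linarith
  qed
  ultimately have "(N * N)\<^sup>2 \<le> (real CARD('j) * (C\<^sup>2 + l2) * r * N)\<^sup>2"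
    by (simp add: power2_eq_square algebra_simps)
  then have "N * N \<le> real CARD('j) * (C\<^sup>2 + l2) * r * N"
    by (rule power2_le_imp_le) (use N0 r l2_pos in auto)
  then have "N \<le> real CARD('j) * (C\<^sup>2 + l2) * r"
    using N0 r l2_pos by (cases "N = 0") auto
  then show ?thesis by (simp add: N_def)
qed

text \<open>Comparison with the competitor \<open>0\<close>, whose loss does not depend on \<open>\<lambda>\<^sub>2\<close>: a strongly penalized
  ridge estimator is close to \<open>0\<close>.\<close>

lemma ridge_shrinkage:
  assumes g: "ridge_estimator \<Omega> \<kappa> H ip u x n l2 g"
  shows "l2 * (ip_norm (ip j) (g j))\<^sup>2 \<le> 1 / real n * (\<Sum>i=1..n. (u i)\<^sup>2)"
proof -
  note g' = g[unfolded ridge_is_full_oracle]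
  note g_mem = oracle_mem[OF g']
  have "\<L> g \<le> \<L> (\<lambda>j t. 0)" by (rule oracle_minimal[OF g']) auto
  also have "\<dots> = 1 / (2 * real n) * (\<Sum>i=1..n. (u i)\<^sup>2)"
    by (subst loss_eq) (simp_all add: comp.ip_zero_left)
  finally have "l2 / 2 * (\<Sum>k\<in>UNIV. ip k (g k) (g k)) \<le> 1 / (2 * real n) * (\<Sum>i=1..n. (u i)\<^sup>2)"
    unfolding loss_eq[OF g_mem]
    by (smt (verit) sum_nonneg zero_le_power2 zero_le_divide_1_iff of_nat_0_le_iff mult_nonneg_nonneg)
  moreover have "l2 / 2 * ip j (g j) (g j) \<le> l2 / 2 * (\<Sum>k\<in>UNIV. ip k (g k) (g k))"
    using l2_pos g_mem
    by (intro mult_left_mono member_le_sum) (auto simp: comp.ip_nonneg)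
  ultimately show ?thesis using g_mem by (simp add: comp.ip_norm_square)
qed

end


section \<open>Penalty weights and the maximum norm\<close>

lemma penalty_deriv_ge_near_zero:
  assumes lim: "\<exists>d. (deriv p \<longlongrightarrow> d) (at_right 0) \<and> d \<ge> c"
    and near: "\<And>t. t \<in> {0<..b} \<Longrightarrow> deriv p t \<ge> c"
    and t: "0 \<le> t" "t \<le> b"
  shows "c \<le> penalty_deriv p t"
proof (cases "t = 0")
  case True
  obtain d where "(deriv p \<longlongrightarrow> d) (at_right 0)" "d \<ge> c" using lim by blast
  then show ?thesis using True by (simp add: penalty_deriv_def tendsto_Lim)
qed (use near t in \<open>simp add: penalty_deriv_def\<close>)

lemma le_tuple_max_norm:
  fixes ip :: "'j::finite \<Rightarrow> 'a inner"
  assumes "j \<in> A" shows "ip_norm (ip j) (g j) \<le> tuple_max_norm ip A g"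
  unfolding tuple_max_norm_def using assms by (intro Max_ge) auto

lemma tuple_max_norm_nonneg:
  fixes ip :: "'j::finite \<Rightarrow> 'a inner"
  shows "0 \<le> tuple_max_norm ip A g"
  unfolding tuple_max_norm_def by (intro Max_ge) auto


section \<open>High-probability events and measurability\<close>

lemma whp_eventually_mono:
  assumes E: "whp M E" and imp: "\<forall>\<^sub>F n in sequentially. \<forall>\<omega>\<in>space M. E n \<omega> \<longrightarrow> F n \<omega>"
  shows "whp M F"
proof -
  obtain A where A: "\<And>n. A n \<in> sets M" "\<And>n. A n \<subseteq> {\<omega> \<in> space M. E n \<omega>}"
    and lim: "(\<lambda>n. measure M (A n)) \<longlonglongrightarrow> 1"
    using E unfolding whp_def by blast
  obtain N where N: "\<And>n. n \<ge> N \<Longrightarrow> \<forall>\<omega>\<in>space M. E n \<omega> \<longrightarrow> F n \<omega>"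
    using imp unfolding eventually_sequentially by blast
  define B where "B n = (if n \<ge> N then A n else {})" for n
  have "\<forall>\<^sub>F n in sequentially. measure M (A n) = measure M (B n)"
    using eventually_ge_at_top[of N] by eventually_elim (simp add: B_def)
  with lim have "(\<lambda>n. measure M (B n)) \<longlonglongrightarrow> 1" by (rule Lim_transform_eventually)
  moreover have "B n \<in> sets M \<and> B n \<subseteq> {\<omega> \<in> space M. F n \<omega>}" for n
    using A(1)[of n] A(2)[of n] N[of n] by (auto simp: B_def)
  ultimately show ?thesis unfolding whp_def by blast
qed

lemma (in prob_space) whp_conj:
  assumes "whp M E" "whp M F"
  shows "whp M (\<lambda>n \<omega>. E n \<omega> \<and> F n \<omega>)"
proof -
  obtain A where A: "\<And>n. A n \<in> sets M" "\<And>n. A n \<subseteq> {\<omega> \<in> space M. E n \<omega>}" "(\<lambda>n. prob (A n)) \<longlonglongrightarrow> 1"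
    using assms(1) unfolding whp_def by blast
  obtain B where B: "\<And>n. B n \<in> sets M" "\<And>n. B n \<subseteq> {\<omega> \<in> space M. F n \<omega>}" "(\<lambda>n. prob (B n)) \<longlonglongrightarrow> 1"
    using assms(2) unfolding whp_def by blast
  have "(\<lambda>n. prob (A n \<inter> B n)) \<longlonglongrightarrow> 1"
  proof (rule tendsto_sandwich)
    show "\<forall>\<^sub>F n in sequentially. prob (A n) + prob (B n) - 1 \<le> prob (A n \<inter> B n)"
    proof (intro always_eventually allI)
      fix n
      show "prob (A n) + prob (B n) - 1 \<le> prob (A n \<inter> B n)"
        using measure_Un3[of "A n" M "B n"] A(1) B(1) prob_le_1[of "A n \<union> B n"]
        by (simp add: fmeasurable_eq_sets)
    qed
    show "(\<lambda>n. prob (A n) + prob (B n) - 1) \<longlonglongrightarrow> 1"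
      using tendsto_diff[OF tendsto_add[OF A(3) B(3)] tendsto_const[of 1]] by simp
  qed auto
  then show ?thesis
    unfolding whp_def using A B by (intro exI[of _ "\<lambda>n. A n \<inter> B n"]) blast
qed

text \<open>For a deterministic sequence, being bounded by the averages on events of probability above
  one half suffices: integrating over the event gives \<open>q n / 2 \<le> V\<close>.\<close>

lemma (in prob_space) eventually_le_of_whp_le_average:
  fixes q :: "nat \<Rightarrow> real" and Z :: "nat \<Rightarrow> 'a \<Rightarrow> real"
  assumes E: "whp M E"
    and Z: "\<And>i. i \<ge> 1 \<Longrightarrow> integrable M (Z i)" "\<And>i. i \<ge> 1 \<Longrightarrow> expectation (Z i) = V"
      "\<And>i \<omega>. 0 \<le> Z i \<omega>"
    and q: "\<And>n. 0 \<le> q n"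
    and le: "\<And>n \<omega>. n \<ge> 1 \<Longrightarrow> \<omega> \<in> space M \<Longrightarrow> E n \<omega> \<Longrightarrow> q n \<le> 1 / real n * (\<Sum>i=1..n. Z i \<omega>)"
  shows "\<forall>\<^sub>F n in sequentially. q n \<le> 2 * V"
proof -
  obtain A where A: "\<And>n. A n \<in> sets M" "\<And>n. A n \<subseteq> {\<omega> \<in> space M. E n \<omega>}"
    and lim: "(\<lambda>n. prob (A n)) \<longlonglongrightarrow> 1"
    using E unfolding whp_def by blast
  have "\<forall>\<^sub>F n in sequentially. 1 / 2 < prob (A n)"
    using lim by (rule order_tendstoD) simp
  then show ?thesis
    using eventually_ge_at_top[of 1]
  proof eventually_elim
    case (elim n)
    have "q n * (1 / 2) \<le> q n * prob (A n)" using elim q by (intro mult_left_mono) auto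
    also have "\<dots> = expectation (\<lambda>\<omega>. q n * indicator (A n) \<omega>)" using A(1) by simp
    also have "\<dots> \<le> expectation (\<lambda>\<omega>. 1 / real n * (\<Sum>i=1..n. Z i \<omega>))"
    proof (rule integral_mono)
      show "integrable M (\<lambda>\<omega>. q n * indicator (A n) \<omega>)"
        using A(1)[of n] by (intro integrable_mult_right integrable_real_indicator) (auto simp: emeasure_eq_measure)
      show "integrable M (\<lambda>\<omega>. 1 / real n * (\<Sum>i=1..n. Z i \<omega>))"
        using Z(1) by (intro integrable_mult_right Bochner_Integration.integrable_sum) auto
      show "q n * indicator (A n) \<omega> \<le> 1 / real n * (\<Sum>i=1..n. Z i \<omega>)" if "\<omega> \<in> space M" for \<omega>
        using le[of n \<omega>] elim that A(2)[of n] Z(3)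
        by (auto simp: indicator_def intro!: mult_nonneg_nonneg sum_nonneg divide_nonneg_nonneg)
    qed
    also have "\<dots> = 1 / real n * (\<Sum>i=1..n. expectation (Z i))"
      using Z(1) by (subst integral_mult_right_zero, subst Bochner_Integration.integral_sum) auto
    also have "\<dots> = V" using elim Z(2) by simp
    finally show ?case by simp
  qed
qed

lemma openin_subsets_mspace: "{W. openin (mtopology_of S) W} \<subseteq> Pow (mspace S)"
  using openin_subset[of "mtopology_of S"] by auto

lemma space_metric_borel [simp]: "space (metric_borel S) = mspace S"
  unfolding metric_borel_def by (rule space_measure_of) (rule openin_subsets_mspace)

lemma borel_measurable_mdist:
  assumes "z \<in> mspace S"
  shows "(\<lambda>w. mdist S w z) \<in> borel_measurable (metric_borel S)"
proof (rule borel_measurableI)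
  fix V :: "real set" assume "open V"
  have "continuous_map (mtopology_of S) euclideanreal (\<lambda>w. mdist S w z)"
    using assms by (intro continuous_map_mdist) (auto simp: continuous_map_const)
  then have "openin (mtopology_of S) {w \<in> mspace S. mdist S w z \<in> V}"
    using \<open>open V\<close> openin_continuous_map_preimage[of "mtopology_of S" euclideanreal _ V]
    by simp
  then have "{w \<in> mspace S. mdist S w z \<in> V} \<in> sets (metric_borel S)"
    unfolding metric_borel_def sets_measure_of[OF openin_subsets_mspace]
    by (intro sigma_sets.Basic) simp
  moreover have "(\<lambda>w. mdist S w z) -` V \<inter> space (metric_borel S) = {w \<in> mspace S. mdist S w z \<in> V}"
    by auto
  ultimately show "(\<lambda>w. mdist S w z) -` V \<inter> space (metric_borel S) \<in> sets (metric_borel S)" by simp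
qed


section \<open>Oracle property of the one-step estimator\<close>

theorem theorem5:
  fixes M :: "'w measure"
    and SX :: "'j::finite \<Rightarrow> 'x metric" and SY :: "'y metric"
    and X :: "'w \<Rightarrow> 'j \<Rightarrow> 'x" and Y :: "'w \<Rightarrow> 'y"
    and Xs :: "nat \<Rightarrow> 'w \<Rightarrow> 'j \<Rightarrow> 'x" and Ys :: "nat \<Rightarrow> 'w \<Rightarrow> 'y"
    and \<kappa> :: "'j \<Rightarrow> 'x \<Rightarrow> 'x \<Rightarrow> real"
    and H :: "'j \<Rightarrow> ('x \<Rightarrow> real) set" and ip :: "'j \<Rightarrow> 'x inner"
    and y y0 :: 'y and U :: "'y \<Rightarrow> real"
    and f :: "'j \<Rightarrow> 'x \<Rightarrow> real" and S0 :: "'j set"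
    and \<epsilon> :: "'w \<Rightarrow> real"
    and C a1 a2 a a0 :: real
    and lam1 lam2 :: "nat \<Rightarrow> real"
    and P :: "real \<Rightarrow> real \<Rightarrow> real"
    and fstar finit flla :: "nat \<Rightarrow> 'w \<Rightarrow> 'j \<Rightarrow> 'x \<Rightarrow> real"
  defines "XYspace \<equiv> (\<Pi>\<^sub>M j\<in>UNIV. metric_borel (SX j)) \<Otimes>\<^sub>M metric_borel SY"
    and "\<Omega> \<equiv> \<lambda>j. mspace (SX j)"
    and "U \<equiv> \<lambda>z. (mdist SY z y)\<^sup>2 - (mdist SY z y0)\<^sup>2"
    and "S0 \<equiv> {j. f j \<noteq> (\<lambda>t. 0)}"
    and "a0 \<equiv> min 1 a2"
  assumes prob: "prob_space M"
    and separable: "\<And>j. separable_metric (SX j)"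
    and XY: "(\<lambda>\<omega>. (X \<omega>, Y \<omega>)) \<in> measurable M XYspace"
    and indep: "prob_space.indep_vars M (\<lambda>_. XYspace) (\<lambda>i \<omega>. (Xs i \<omega>, Ys i \<omega>)) {1..}"
    and ident: "\<And>i. i \<ge> 1 \<Longrightarrow>
        distr M XYspace (\<lambda>\<omega>. (Xs i \<omega>, Ys i \<omega>)) = distr M XYspace (\<lambda>\<omega>. (X \<omega>, Y \<omega>))"
    and y: "y \<in> mspace SY" and y0: "y0 \<in> mspace SY"
    and kernel: "\<And>j. pos_def_kernel (\<Omega> j) (\<kappa> j)"
    and rkhs: "\<And>j. rkhs (\<Omega> j) (\<kappa> j) (H j) (ip j)"
    and f_in: "\<And>j. f j \<in> H j"
    and eps_meas: "\<epsilon> \<in> borel_measurable M"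
    and model: "\<And>\<omega>. \<omega> \<in> space M \<Longrightarrow> U (Y \<omega>) = (\<Sum>j\<in>UNIV. f j (X \<omega> j)) + \<epsilon> \<omega>"
    and eps_centered: "AE \<omega> in M.
        real_cond_exp M (vimage_algebra (space M) X (\<Pi>\<^sub>M j\<in>UNIV. metric_borel (SX j))) \<epsilon> \<omega> = 0"
    and bd_kernel: "\<And>j x. x \<in> \<Omega> j \<Longrightarrow> ip_norm (ip j) (ksec (\<Omega> j) (\<kappa> j) x) < C"
    and bd_f: "sqrt (\<Sum>j\<in>UNIV. (ip_norm (ip j) (f j))\<^sup>2) < C"
    and bd_eps: "integrable M (\<lambda>\<omega>. (\<epsilon> \<omega>)\<^sup>2)" "(\<integral>\<omega>. (\<epsilon> \<omega>)\<^sup>2 \<partial>M) < C"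
    and bd_diag: "\<And>j. integrable M (\<lambda>\<omega>. \<kappa> j (X \<omega> j) (X \<omega> j))"
        "\<And>j. (\<integral>\<omega>. \<kappa> j (X \<omega> j) (X \<omega> j) \<partial>M) < C"
    and lam1_pos: "\<And>n. lam1 n > 0" and lam2_pos: "\<And>n. lam2 n > 0"
    and lam1_lim: "lam1 \<longlonglongrightarrow> 0"
    and a_consts: "a1 > 0" "a2 > 0" "a > a2"
    and pen_i: "\<And>l. l > 0 \<Longrightarrow> mono_on {0..} (P l)" "\<And>l. l > 0 \<Longrightarrow> concave_on {0..} (P l)"
        "\<And>l. l > 0 \<Longrightarrow> P l 0 = 0"
    and pen_ii: "\<And>l t. l > 0 \<Longrightarrow> t > 0 \<Longrightarrow> P l differentiable at t"
        "\<And>l. l > 0 \<Longrightarrow> \<exists>d. (deriv (P l) \<longlongrightarrow> d) (at_right 0) \<and> d \<ge> a1 * l"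
    and pen_iii: "\<And>l t. l > 0 \<Longrightarrow> t \<in> {0<..a2 * l} \<Longrightarrow> deriv (P l) t \<ge> a1 * l"
    and pen_iv: "\<And>l t. l > 0 \<Longrightarrow> t \<ge> a * l \<Longrightarrow> deriv (P l) t = 0"
    and signal: "\<And>n j. n \<ge> 1 \<Longrightarrow> j \<in> S0 \<Longrightarrow> ip_norm (ip j) (f j) > (a + 1) * lam1 n"
    and f_star: "\<And>n \<omega>. n \<ge> 1 \<Longrightarrow> \<omega> \<in> space M \<Longrightarrow>
        oracle_estimator \<Omega> \<kappa> H ip S0 (\<lambda>i. U (Ys i \<omega>)) (\<lambda>i. Xs i \<omega>) n (lam2 n) (fstar n \<omega>)"
    and lla: "\<And>n \<omega>. n \<ge> 1 \<Longrightarrow> \<omega> \<in> space M \<Longrightarrow>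
        lla_estimator \<Omega> \<kappa> H ip (P (lam1 n)) (finit n \<omega>)
          (\<lambda>i. U (Ys i \<omega>)) (\<lambda>i. Xs i \<omega>) n (lam2 n) (flla n \<omega>)"
  shows
    "((\<forall>n\<ge>1. \<forall>\<omega>\<in>space M.
          ridge_estimator \<Omega> \<kappa> H ip (\<lambda>i. U (Ys i \<omega>)) (\<lambda>i. Xs i \<omega>) n (lam2 n) (finit n \<omega>)) \<and>
      S0 \<noteq> {} \<and>
      (\<exists>r \<in> o(lam1). whp M (\<lambda>n \<omega>. tuple_max_norm ip UNIV (\<lambda>j t. finit n \<omega> j t - f j t) \<le> r n))
      \<longrightarrow> whp M (\<lambda>n \<omega>. flla n \<omega> = fstar n \<omega>))
     \<and>
     ((\<forall>n\<ge>1. \<forall>\<omega>\<in>space M.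
          elastic_net_estimator \<Omega> \<kappa> H ip
            (\<lambda>i. U (Ys i \<omega>)) (\<lambda>i. Xs i \<omega>) n (lam1 n) (lam2 n) (finit n \<omega>)) \<and>
      a0 + a1 < a \<and>
      whp M (\<lambda>n \<omega>. tuple_max_norm ip UNIV (\<lambda>j t. finit n \<omega> j t - f j t) \<le> a0 * lam1 n) \<and>
      whp M (\<lambda>n \<omega>. tuple_max_norm ip (- S0)
          (loss_grad \<Omega> \<kappa> (\<lambda>i. U (Ys i \<omega>)) (\<lambda>i. Xs i \<omega>) n (lam2 n) (fstar n \<omega>)) < a1 * lam1 n)
      \<longrightarrow> whp M (\<lambda>n \<omega>. flla n \<omega> = fstar n \<omega>))"
proof -
  interpret prob_space M by (rule prob)
  have C0: "0 \<le> C"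
    using bd_f by (smt (verit) real_sqrt_ge_zero sum_nonneg zero_le_power2)
  have XYs: "(\<lambda>\<omega>. (Xs i \<omega>, Ys i \<omega>)) \<in> measurable M XYspace" if "i \<ge> 1" for i
    using indep that unfolding indep_vars_def by auto
  have Xs_in: "Xs i \<omega> j \<in> \<Omega> j" if "i \<ge> 1" "\<omega> \<in> space M" for i \<omega> j
    using measurable_space[OF XYs[OF that(1)] that(2)]
    by (auto simp: XYspace_def \<Omega>_def space_pair_measure space_PiM)
  have X_in: "X \<omega> j \<in> \<Omega> j" if "\<omega> \<in> space M" for \<omega> j
    using measurable_space[OF XY that]
    by (auto simp: XYspace_def \<Omega>_def space_pair_measure space_PiM)
  have sample: "additive_sample \<Omega> \<kappa> H ip (\<lambda>i. Xs i \<omega>) n (lam2 n) C"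
    if "\<omega> \<in> space M" for n \<omega>
    by unfold_locales (use rkhs Xs_in that lam2_pos bd_kernel C0 in \<open>auto intro: less_imp_le\<close>)
  have space: "reproducing_kernel_space (\<Omega> j) (\<kappa> j) (H j) (ip j)" for j
    by unfold_locales (rule rkhs)
  have a0: "0 < a0" "a0 \<le> 1" "a0 \<le> a2" using a_consts by (auto simp: a0_def)

  \<comment> \<open>membership in the spaces \<open>H j\<close> is part of the event, since it is known only for \<open>n \<ge> 1\<close>\<close>
  define good where "good n \<omega> \<longleftrightarrow>
      (\<forall>j. finit n \<omega> j \<in> H j) \<and>
      tuple_max_norm ip UNIV (\<lambda>j t. finit n \<omega> j t - f j t) \<le> a0 * lam1 n" for n \<omega>
  have init_lower: "ip_norm (ip j) (f j) - lam1 n \<le> ip_norm (ip j) (finit n \<omega> j)"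
    if "good n \<omega>" for n \<omega> j
  proof -
    have "ip_norm (ip j) (\<lambda>t. finit n \<omega> j t - f j t) \<le> a0 * lam1 n"
      using that le_tuple_max_norm[of j UNIV ip "\<lambda>j t. finit n \<omega> j t - f j t"]
      by (auto simp: good_def)
    also have "\<dots> \<le> lam1 n" using a0 lam1_pos[of n] by simp
    finally show ?thesis
      using reproducing_kernel_space.reverse_triangle_ineq[OF space f_in, of "finit n \<omega> j" j] that
      by (auto simp: good_def)
  qed
  have oracle_property: "flla n \<omega> = fstar n \<omega>"
    if n: "n \<ge> 1" and \<omega>: "\<omega> \<in> space M" and good: "good n \<omega>"
      and grad: "\<And>j. j \<notin> S0 \<Longrightarrow>
        ip_norm (ip j) (loss_grad \<Omega> \<kappa> (\<lambda>i. U (Ys i \<omega>)) (\<lambda>i. Xs i \<omega>) n (lam2 n) (fstar n \<omega>) j) \<le> a1 * lam1 n"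
    for n \<omega>
  proof (rule additive_sample.lla_eq_oracle[OF sample[OF \<omega>] f_star[OF n \<omega>] lla[OF n \<omega>]])
    fix j assume j: "j \<in> S0"
    have "a * lam1 n \<le> ip_norm (ip j) (finit n \<omega> j)"
      using init_lower[OF good, of j] signal[OF n j] by (simp add: algebra_simps)
    moreover have "0 < a * lam1 n" using a_consts lam1_pos[of n] by simp
    ultimately show "penalty_deriv (P (lam1 n)) (ip_norm (ip j) (finit n \<omega> j)) = 0"
      using pen_iv[OF lam1_pos] by (simp add: penalty_deriv_def)
  next
    fix j assume j: "j \<notin> S0"
    then have "f j = (\<lambda>t. 0)" by (simp add: S0_def)
    then have "ip_norm (ip j) (finit n \<omega> j) \<le> a0 * lam1 n"
      using good le_tuple_max_norm[of j UNIV ip "\<lambda>j t. finit n \<omega> j t - f j t"]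
      by (auto simp: good_def)
    also have "\<dots> \<le> a2 * lam1 n" using a0 lam1_pos[of n] by simp
    finally have "a1 * lam1 n \<le> penalty_deriv (P (lam1 n)) (ip_norm (ip j) (finit n \<omega> j))"
      using good reproducing_kernel_space.ip_norm_nonneg[OF space]
      by (intro penalty_deriv_ge_near_zero[OF pen_ii(2)[OF lam1_pos] pen_iii[OF lam1_pos]])
        (auto simp: good_def)
    with grad[OF j]
    show "ip_norm (ip j) (loss_grad \<Omega> \<kappa> (\<lambda>i. U (Ys i \<omega>)) (\<lambda>i. Xs i \<omega>) n (lam2 n) (fstar n \<omega>) j)
        \<le> penalty_deriv (P (lam1 n)) (ip_norm (ip j) (finit n \<omega> j))" by simp
  qed

  have elastic_net: "whp M (\<lambda>n \<omega>. flla n \<omega> = fstar n \<omega>)"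
    if init: "\<forall>n\<ge>1. \<forall>\<omega>\<in>space M. elastic_net_estimator \<Omega> \<kappa> H ip
          (\<lambda>i. U (Ys i \<omega>)) (\<lambda>i. Xs i \<omega>) n (lam1 n) (lam2 n) (finit n \<omega>)"
      and close: "whp M (\<lambda>n \<omega>. tuple_max_norm ip UNIV (\<lambda>j t. finit n \<omega> j t - f j t) \<le> a0 * lam1 n)"
      and grad: "whp M (\<lambda>n \<omega>. tuple_max_norm ip (- S0)
          (loss_grad \<Omega> \<kappa> (\<lambda>i. U (Ys i \<omega>)) (\<lambda>i. Xs i \<omega>) n (lam2 n) (fstar n \<omega>)) < a1 * lam1 n)"
  proof (rule whp_eventually_mono[OF whp_conj[OF close grad]])
    show "\<forall>\<^sub>F n in sequentially. \<forall>\<omega>\<in>space M.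
        tuple_max_norm ip UNIV (\<lambda>j t. finit n \<omega> j t - f j t) \<le> a0 * lam1 n \<and>
        tuple_max_norm ip (- S0)
          (loss_grad \<Omega> \<kappa> (\<lambda>i. U (Ys i \<omega>)) (\<lambda>i. Xs i \<omega>) n (lam2 n) (fstar n \<omega>)) < a1 * lam1 n
        \<longrightarrow> flla n \<omega> = fstar n \<omega>"
      using eventually_ge_at_top[of 1]
    proof eventually_elim
      case (elim n)
      show ?case
      proof (intro ballI impI, elim conjE)
        fix \<omega> assume \<omega>: "\<omega> \<in> space M"
          and c: "tuple_max_norm ip UNIV (\<lambda>j t. finit n \<omega> j t - f j t) \<le> a0 * lam1 n"
          and d: "tuple_max_norm ip (- S0)
            (loss_grad \<Omega> \<kappa> (\<lambda>i. U (Ys i \<omega>)) (\<lambda>i. Xs i \<omega>) n (lam2 n) (fstar n \<omega>)) < a1 * lam1 n"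
        have "good n \<omega>"
          using init elim \<omega> c by (auto simp: good_def elastic_net_estimator_def is_arg_min_def)
        then show "flla n \<omega> = fstar n \<omega>"
        proof (rule oracle_property[OF elim \<omega>])
          fix j assume "j \<notin> S0"
          then show "ip_norm (ip j) (loss_grad \<Omega> \<kappa> (\<lambda>i. U (Ys i \<omega>)) (\<lambda>i. Xs i \<omega>) n (lam2 n) (fstar n \<omega>) j)
              \<le> a1 * lam1 n"
            using d le_tuple_max_norm[of j "- S0" ip
                "loss_grad \<Omega> \<kappa> (\<lambda>i. U (Ys i \<omega>)) (\<lambda>i. Xs i \<omega>) n (lam2 n) (fstar n \<omega>)"] by simp
        qed
      qed
    qed
  qed

  have ridge: "whp M (\<lambda>n \<omega>. flla n \<omega> = fstar n \<omega>)"
    if init: "\<forall>n\<ge>1. \<forall>\<omega>\<in>space M. ridge_estimator \<Omega> \<kappa> H ip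
          (\<lambda>i. U (Ys i \<omega>)) (\<lambda>i. Xs i \<omega>) n (lam2 n) (finit n \<omega>)"
      and ne: "S0 \<noteq> {}" and r: "r \<in> o(lam1)"
      and close: "whp M (\<lambda>n \<omega>. tuple_max_norm ip UNIV (\<lambda>j t. finit n \<omega> j t - f j t) \<le> r n)" for r
  proof -
    have r_le: "\<forall>\<^sub>F n in sequentially. \<bar>r n\<bar> \<le> c * lam1 n" if "0 < c" for c
      using landau_o.smallD[OF r that]
      by eventually_elim (use lam1_pos in \<open>simp add: less_imp_le\<close>)
    have ridge_mem: "finit n \<omega> j \<in> H j" if "n \<ge> 1" "\<omega> \<in> space M" for n \<omega> j
      using init that by (auto simp: ridge_estimator_def is_arg_min_def)
    have ridge_good: "whp M good"
    proof (rule whp_eventually_mono[OF close])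
      show "\<forall>\<^sub>F n in sequentially. \<forall>\<omega>\<in>space M.
          tuple_max_norm ip UNIV (\<lambda>j t. finit n \<omega> j t - f j t) \<le> r n \<longrightarrow> good n \<omega>"
        using r_le[OF a0(1)] eventually_ge_at_top[of 1]
        by eventually_elim (use ridge_mem in \<open>auto simp: good_def\<close>)
    qed

    have U_meas: "U \<in> borel_measurable (metric_borel SY)"
      unfolding U_def using borel_measurable_mdist[OF y] borel_measurable_mdist[OF y0] by simp
    have W_meas: "(\<lambda>z. (U (snd z))\<^sup>2) \<in> borel_measurable XYspace"
      unfolding XYspace_def using U_meas by measurable
    define B where "B = (\<Sum>j\<in>UNIV. ip_norm (ip j) (f j) * C)"
    \<comment> \<open>the responses are square integrable: the regression part is bounded by \<open>B\<close>\<close>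
    have U2_le: "(U (Y \<omega>))\<^sup>2 \<le> 2 * B\<^sup>2 + 2 * (\<epsilon> \<omega>)\<^sup>2" if \<omega>: "\<omega> \<in> space M" for \<omega>
    proof -
      have "\<bar>\<Sum>j\<in>UNIV. f j (X \<omega> j)\<bar> \<le> (\<Sum>j\<in>UNIV. \<bar>f j (X \<omega> j)\<bar>)" by (rule sum_abs)
      also have "\<dots> \<le> B"
        unfolding B_def using bd_kernel X_in[OF \<omega>]
        by (intro sum_mono reproducing_kernel_space.eval_le[OF space _ f_in]) (auto intro: less_imp_le)
      finally have "(\<Sum>j\<in>UNIV. f j (X \<omega> j))\<^sup>2 \<le> B\<^sup>2"
        by (metis abs_ge_zero power2_abs power_mono)
      moreover have "(s + t)\<^sup>2 \<le> 2 * s\<^sup>2 + 2 * t\<^sup>2" for s t :: real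
        using zero_le_power2[of "s - t"] by (simp add: power2_sum power2_diff)
      ultimately show ?thesis unfolding model[OF \<omega>] by (smt (verit))
    qed
    have U2_meas: "(\<lambda>\<omega>. (U (Y \<omega>))\<^sup>2) \<in> borel_measurable M"
      using measurable_compose[OF XY W_meas] by simp
    have "integrable M (\<lambda>\<omega>. (U (Y \<omega>))\<^sup>2)"
      by (rule Bochner_Integration.integrable_bound[of _ "\<lambda>\<omega>. 2 * B\<^sup>2 + 2 * (\<epsilon> \<omega>)\<^sup>2"])
        (use bd_eps(1) U2_meas U2_le in \<open>auto intro!: AE_I2\<close>)
    then have W_int: "integrable (distr M XYspace (\<lambda>\<omega>. (X \<omega>, Y \<omega>))) (\<lambda>z. (U (snd z))\<^sup>2)"
      using integrable_distr_eq[OF XY W_meas] by simp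
    define V where "V = (\<integral>z. (U (snd z))\<^sup>2 \<partial>distr M XYspace (\<lambda>\<omega>. (X \<omega>, Y \<omega>)))"
    have Us_int: "integrable M (\<lambda>\<omega>. (U (Ys i \<omega>))\<^sup>2)" if "i \<ge> 1" for i
      using W_int integrable_distr_eq[OF XYs[OF that] W_meas] by (simp add: ident[OF that])
    have Us_mean: "expectation (\<lambda>\<omega>. (U (Ys i \<omega>))\<^sup>2) = V" if "i \<ge> 1" for i
      using integral_distr[OF XYs[OF that] W_meas] by (simp add: ident[OF that] V_def)

    \<comment> \<open>\<open>c\<close> is a lower bound, independent of \<open>n\<close>, for the \<open>j0\<close>-th ridge component: the error is at
      most \<open>\<lambda>\<^sub>1\<close>, which the signal condition bounds by the fraction \<open>1 / (a + 1)\<close> of \<open>\<parallel>f j0\<parallel>\<close>\<close>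
    obtain j0 where j0: "j0 \<in> S0" using ne by blast
    define c where "c = a / (a + 1) * ip_norm (ip j0) (f j0)"
    have a_pos: "0 < a" using a_consts by linarith
    have "0 < ip_norm (ip j0) (f j0)"
      using signal[of 1 j0] j0 lam1_pos[of 1] a_pos mult_pos_pos[of "a + 1" "lam1 1"] by linarith
    then have c_pos: "0 < c" using a_pos by (simp add: c_def)
    have "\<forall>\<^sub>F n in sequentially. lam2 n * c\<^sup>2 \<le> 2 * V"
    proof (rule eventually_le_of_whp_le_average[OF ridge_good Us_int Us_mean])
      show "0 \<le> lam2 n * c\<^sup>2" for n using lam2_pos[of n] by simp
      fix n \<omega> assume n: "n \<ge> 1" and \<omega>: "\<omega> \<in> space M" and good: "good n \<omega>"
      have "lam1 n \<le> ip_norm (ip j0) (f j0) / (a + 1)"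
        using signal[OF n j0] a_pos by (simp add: field_simps)
      moreover have "c = ip_norm (ip j0) (f j0) - ip_norm (ip j0) (f j0) / (a + 1)"
        using a_pos by (simp add: c_def field_simps)
      ultimately have "c \<le> ip_norm (ip j0) (finit n \<omega> j0)"
        using init_lower[OF good, of j0] by linarith
      then have "lam2 n * c\<^sup>2 \<le> lam2 n * (ip_norm (ip j0) (finit n \<omega> j0))\<^sup>2"
        using c_pos lam2_pos[of n] by (intro mult_left_mono power_mono) auto
      also have "\<dots> \<le> 1 / real n * (\<Sum>i=1..n. (U (Ys i \<omega>))\<^sup>2)"
        using init n \<omega> by (intro additive_sample.ridge_shrinkage[OF sample[OF \<omega>]]) auto
      finally show "lam2 n * c\<^sup>2 \<le> 1 / real n * (\<Sum>i=1..n. (U (Ys i \<omega>))\<^sup>2)" .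
    qed auto
    then have lam2_le: "\<forall>\<^sub>F n in sequentially. lam2 n \<le> 2 * V / c\<^sup>2"
      by eventually_elim (use c_pos in \<open>simp add: field_simps\<close>)

    \<comment> \<open>the summand \<open>1\<close> makes \<open>K\<close> positive, so that \<open>a1 / K\<close> is an admissible little-o constant\<close>
    define K where "K = real CARD('j) * (C\<^sup>2 + 2 * V / c\<^sup>2) + 1"
    have V_nonneg: "0 \<le> V" unfolding V_def by (rule integral_nonneg_AE) simp
    have K_pos: "0 < K" unfolding K_def using V_nonneg by (intro add_nonneg_pos mult_nonneg_nonneg) auto
    show ?thesis
    proof (rule whp_eventually_mono[OF whp_conj[OF close ridge_good]])
      show "\<forall>\<^sub>F n in sequentially. \<forall>\<omega>\<in>space M.
          tuple_max_norm ip UNIV (\<lambda>j t. finit n \<omega> j t - f j t) \<le> r n \<and> good n \<omega>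
          \<longrightarrow> flla n \<omega> = fstar n \<omega>"
        using eventually_ge_at_top[of 1] lam2_le r_le[OF divide_pos_pos[OF a_consts(1) K_pos]]
      proof eventually_elim
        case (elim n)
        show ?case
        proof (intro ballI impI, elim conjE)
          fix \<omega> assume \<omega>: "\<omega> \<in> space M" and good: "good n \<omega>"
            and rn: "tuple_max_norm ip UNIV (\<lambda>j t. finit n \<omega> j t - f j t) \<le> r n"
          have r0: "0 \<le> r n" using rn tuple_max_norm_nonneg order_trans by blast
          show "flla n \<omega> = fstar n \<omega>"
          proof (rule oracle_property[OF elim(1) \<omega> good])
            fix j assume "j \<notin> S0"
            have "ip_norm (ip k) (finit n \<omega> k) \<le> r n" if "k \<notin> S0" for k
              using that rn le_tuple_max_norm[of k UNIV ip "\<lambda>j t. finit n \<omega> j t - f j t"]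
              by (auto simp: S0_def)
            then have "ip_norm (ip j) (loss_grad \<Omega> \<kappa> (\<lambda>i. U (Ys i \<omega>)) (\<lambda>i. Xs i \<omega>) n (lam2 n) (fstar n \<omega>) j)
                \<le> real CARD('j) * (C\<^sup>2 + lam2 n) * r n"
              using init elim(1) \<omega> r0
              by (intro additive_sample.oracle_grad_le_ridge_leakage[OF sample[OF \<omega>] f_star[OF elim(1) \<omega>]]) auto
            also have "\<dots> \<le> K * r n"
            proof (rule mult_right_mono[OF _ r0])
              have "real CARD('j) * (C\<^sup>2 + lam2 n) \<le> real CARD('j) * (C\<^sup>2 + 2 * V / c\<^sup>2)"
                using elim(2) by (intro mult_left_mono) auto
              then show "real CARD('j) * (C\<^sup>2 + lam2 n) \<le> K" unfolding K_def by linarith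
            qed
            also have "\<dots> \<le> a1 * lam1 n" using elim(3) K_pos r0 by (simp add: field_simps)
            finally show "ip_norm (ip j) (loss_grad \<Omega> \<kappa> (\<lambda>i. U (Ys i \<omega>)) (\<lambda>i. Xs i \<omega>) n (lam2 n) (fstar n \<omega>) j)
                \<le> a1 * lam1 n" .
          qed
        qed
      qed
    qed
  qed

  show ?thesis using ridge elastic_net by blast
qed

end
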